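(* Let $d\geq 1$, let $f\in L^{\infty }(T^{d})$ with $\Vert f\Vert _{L^{\infty }(T^{d})}\leq 1$, and let $\nu \in \mathbb{Z}^{d}$. Let $E=\{x\in T^{d}:|f(x)|=1\}$ and for $n,k\in \mathbb{Z}$ put \[ b_{n,n-k}=\int_{E}f(x)^{n}e^{-2\pi i(n-k)\nu \cdot x}\,dx . \] Suppose that $\hat{f}(\xi )=0$ for all $\xi $ in a half-space $S$ of lattice points, that $\nu \in -S$, and that $\hat{f}(0)\neq 0$. Then for every $N\in \mathbb{Z}$ and every $k\in \mathbb{Z}$, \[ \sum_{\substack{ m=-\infty \\ m\neq N}}^{\infty }\frac{|b_{m,m-k}|^{2}}{|m-N|}\leq \log \frac{16}{|\hat{f}(0)|^{4}}. \]
   Context: $T^{d}=\mathbb{R}^{d}/\mathbb{Z}^{d}$ is the $d$-dimensional torus with normalized Lebesgue measure $dx$, and $\hat{f}(\xi )=\int_{T^{d}}f(x)e^{-2\pi i\xi \cdot x}dx$ for $\xi \in \mathbb{Z}^{d}$. A set $S\subset \mathbb{Z}^{d}$ is a half-space of lattice points if (i) $0\notin S$; (ii) for every $\xi \neq 0$ in $\mathbb{Z}^d$, $\xi \in S$ or $-\xi \in S$; (iii) $\xi ,\xi ^{\prime }\in S$ implies $\xi +\xi ^{\prime }\in S$. Here $-S=\{-\xi :\xi \in S\}$. *)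

theory Defs
  imports "HOL-Analysis.Analysis"
begin

text \<open>The torus T^d = R^d/Z^d is modelled by its fundamental domain, the unit cube
  [0,1]^d in real^'n (d = CARD('n) \<ge> 1); functions on T^d are functions on the cube,
  and Lebesgue measure restricted to the cube has total mass 1 (normalized measure).\<close>

definition torus :: "(real^'n) set" where
  "torus = cbox 0 1"

definition lattice_dot :: "int^'n \<Rightarrow> real^'n \<Rightarrow> real" where
  "lattice_dot \<xi> x = (\<Sum>i\<in>UNIV. of_int (\<xi> $ i) * x $ i)"

definition fourier_coeff :: "(real^'n \<Rightarrow> complex) \<Rightarrow> int^'n \<Rightarrow> complex" where
  "fourier_coeff f \<xi> =
     integral\<^sup>L (lebesgue_on torus) (\<lambda>x. f x * exp (- (2 * of_real pi * \<i> * of_real (lattice_dot \<xi> x))))"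

definition half_space :: "(int^'n) set \<Rightarrow> bool" where
  "half_space S \<longleftrightarrow> 0 \<notin> S \<and> (\<forall>\<xi>. \<xi> \<noteq> 0 \<longrightarrow> \<xi> \<in> S \<or> -\<xi> \<in> S)
     \<and> (\<forall>\<xi>\<in>S. \<forall>\<xi>'\<in>S. \<xi> + \<xi>' \<in> S)"

definition bcoef :: "(real^'n \<Rightarrow> complex) \<Rightarrow> int^'n \<Rightarrow> int \<Rightarrow> int \<Rightarrow> complex" where
  "bcoef f \<nu> n k =
     integral\<^sup>L (lebesgue_on {x \<in> torus. cmod (f x) = 1})
       (\<lambda>x. f x powi n * exp (- (2 * of_real pi * \<i> * of_int (n - k) * of_real (lattice_dot \<nu> x))))"

end

theory Submission
  imports Defs
begin

text \<open>With \<open>e(t) = exp(2 \<pi> i t)\<close> put \<open>h(x) = f(x) e(-\<nu> x)\<close>, which is unimodular on \<open>E\<close>. The coefficients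
  are the Fourier coefficients of the image of the measure \<open>e(k \<nu> x) dx\<close> on \<open>E\<close> under \<open>h\<close>, so the sum is a
  logarithmic energy, namely the limit for \<open>r \<rightarrow> 1\<close> of integrals over \<open>E \<times> E\<close> of \<open>-2 log |1 - r h(x) cnj (h(y))|\<close>
  times a unimodular factor. For \<open>y\<close> in \<open>E\<close> that modulus is \<open>|F_y(x)|\<close>, where
  \<open>F_y(x) = f(y) e(\<nu> x) - r f(x) e(\<nu> y)\<close> is bounded by \<open>2\<close>, has a spectrum disjoint from \<open>S\<close>, and has
  mean \<open>-r e(\<nu> y)\<close> times the mean of \<open>f\<close>. The Jensen inequality for functions whose spectrum avoids a
  half-space bounds the integral of \<open>log |F_y|\<close> from below.

  That inequality holds because a real trigonometric polynomial \<open>u\<close> is the real part of a polynomial \<open>q\<close> with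
  spectrum in \<open>-S \<union> {0}\<close>, so that \<open>F\<close> times \<open>exp (-q)\<close> has the mean of \<open>F\<close> times \<open>exp (- mean q)\<close>; then
  let \<open>u\<close> approximate \<open>log (|F| + \<epsilon>)\<close>.\<close>

section \<open>Characters and integration over the unit cube\<close>

definition character :: "int^'n \<Rightarrow> real^'n \<Rightarrow> complex" where
  "character \<xi> x = cis (2 * pi * lattice_dot \<xi> x)"

lemma character_0 [simp]: "character 0 x = 1"
  by (simp add: character_def lattice_dot_def)

lemma character_add: "character (\<xi> + \<eta>) x = character \<xi> x * character \<eta> x"
  by (simp add: character_def lattice_dot_def cis_mult algebra_simps sum.distrib)

lemma character_minus: "character (- \<xi>) x = cnj (character \<xi> x)"
  by (simp add: character_def lattice_dot_def cis_cnj sum_negf)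

lemma norm_character [simp]: "cmod (character \<xi> x) = 1"
  by (simp add: character_def)

lemma continuous_on_character [continuous_intros]: "continuous_on A (character \<xi>)"
  unfolding character_def lattice_dot_def by (intro continuous_intros)

lemma exp_lattice_dot: "exp (- (2 * of_real pi * \<i> * of_real (lattice_dot \<xi> x))) = character (- \<xi>) x"
proof -
  have "lattice_dot (- \<xi>) x = - lattice_dot \<xi> x"
    by (simp add: lattice_dot_def sum_negf)
  then show ?thesis
    by (simp add: character_def cis_conv_exp mult_ac)
qed

lemma fourier_coeff_character:
  "fourier_coeff f \<xi> = integral\<^sup>L (lebesgue_on torus) (\<lambda>x. f x * character (- \<xi>) x)"
  unfolding fourier_coeff_def exp_lattice_dot ..

lemma torus_lebesgue [simp, measurable]: "torus \<in> sets lebesgue"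
  by (simp add: torus_def)

lemma inner_one_Basis: "b \<in> Basis \<Longrightarrow> (1::real^'n) \<bullet> b = 1"
  by (auto simp: Basis_vec_def inner_axis)

lemma mem_torus: "x \<in> torus \<longleftrightarrow> (\<forall>b\<in>Basis. x \<bullet> b \<in> {0..1})"
  by (auto simp: torus_def mem_box inner_one_Basis)

lemma emeasure_torus: "emeasure lebesgue (torus :: (real^'n) set) = 1"
  by (simp add: torus_def emeasure_lborel_cbox_eq inner_one_Basis)

lemma finite_measure_torus: "finite_measure (lebesgue_on (torus :: (real^'n) set))"
  by (rule finite_measureI) (simp add: emeasure_restrict_space emeasure_torus del: emeasure_completion)

interpretation torus: finite_measure "lebesgue_on (torus :: (real^'n) set)"
  by (rule finite_measure_torus)

lemma measure_torus [simp]: "measure (lebesgue_on torus) torus = 1"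
  by (simp add: measure_def emeasure_restrict_space emeasure_torus del: emeasure_completion)

lemma character_measurable [measurable]: "character \<xi> \<in> borel_measurable (lebesgue_on torus)"
  by (intro continuous_imp_measurable_on_sets_lebesgue continuous_on_character torus_lebesgue)

lemma integral_cis_unit_interval:
  assumes "a \<in> \<int>" "a \<noteq> 0"
  shows "(\<integral>t. indicator {0..1} t *\<^sub>R cis (2 * pi * a * t) \<partial>lborel) = 0"
proof -
  define F where "F t = cis (2 * pi * a * t) / (2 * pi * a * \<i>)" for t :: real
  have "(F has_vector_derivative cis (2 * pi * a * t)) (at t within {0..1})" for t
  proof -
    have "((\<lambda>z. exp (2 * pi * a * \<i> * z) / (2 * pi * a * \<i>)) has_field_derivative exp (2 * pi * a * \<i> * of_real t)) (at (of_real t))"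
      using assms by (auto intro!: derivative_eq_intros)
    from has_vector_derivative_real_field[OF this] show ?thesis
      by (simp add: F_def[abs_def] cis_conv_exp mult_ac)
  qed
  moreover have "continuous_on {0..1} (\<lambda>t. cis (2 * pi * a * t))"
    by (intro continuous_intros)
  ultimately have "(\<integral>t. indicator {0..1} t *\<^sub>R cis (2 * pi * a * t) \<partial>lborel) = F 1 - F 0"
    by (intro integral_FTC_Icc) auto
  also have "\<dots> = 0"
    using assms cis_multiple_2pi[of a] by (simp add: F_def mult_ac)
  finally show ?thesis .
qed

text \<open>On the cube the character is a product over \<open>Basis\<close> of one-variable
  exponentials, so the integral splits by Fubini, and a coordinate with nonzero integer frequency
  contributes the factor 0.\<close>

lemma integral_character:
  fixes \<xi> :: "int^'n"
  shows "integral\<^sup>L (lebesgue_on torus) (character \<xi>) = (if \<xi> = 0 then 1 else 0)"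
proof (cases "\<xi> = 0")
  case True
  then show ?thesis by (simp add: character_0[abs_def] cong: Bochner_Integration.integral_cong)
next
  case False
  \<comment> \<open>The frequency as a real vector turns \<open>lattice_dot\<close> into an inner
    product, which expands along \<open>Basis\<close>.\<close>
  define w :: "real^'n" where "w = (\<chi> i. of_int (\<xi> $ i))"
  define g where "g b t = indicator {0..1} t *\<^sub>R cis (2 * pi * (w \<bullet> b) * t)" for b and t :: real
  from False obtain i where "\<xi> $ i \<noteq> 0" by (auto simp: vec_eq_iff)
  then have i: "w \<bullet> axis i 1 \<in> \<int>" "w \<bullet> axis i 1 \<noteq> 0" "axis i 1 \<in> (Basis :: (real^'n) set)"
    by (auto simp: w_def inner_axis)
  have "lattice_dot \<xi> x = (\<Sum>b\<in>Basis. (w \<bullet> b) * (x \<bullet> b))" for x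
    using euclidean_inner[of w x] by (simp add: w_def lattice_dot_def inner_vec_def)
  then have eq: "indicator torus x *\<^sub>R character \<xi> x = (\<Prod>b\<in>Basis. g b (x \<bullet> b))" for x
  proof -
    have "cis (\<Sum>b\<in>B. 2 * pi * (w \<bullet> b) * (x \<bullet> b)) = (\<Prod>b\<in>B. cis (2 * pi * (w \<bullet> b) * (x \<bullet> b)))"
      if "finite B" for B
      using that by induction (auto simp: cis_mult[symmetric])
    moreover have "indicator torus x = (\<Prod>b\<in>Basis. indicator {0..1} (x \<bullet> b) :: real)"
      by (auto simp: indicator_def mem_torus prod_zero_iff)
    ultimately show ?thesis
      by (simp add: g_def scaleR_conv_of_real prod.distrib character_def sum_distrib_left mult_ac
        \<open>lattice_dot \<xi> x = _\<close>)
  qed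
  have g_int: "integrable lborel (g b)" for b
    unfolding g_def by (intro borel_integrable_compact continuous_intros) auto
  have [measurable]: "g b \<in> borel_measurable borel" for b
    using g_int[THEN borel_measurable_integrable] by simp
  interpret product_sigma_finite "\<lambda>b::real^'n. lborel :: real measure" ..
  have "integral\<^sup>L (lebesgue_on torus) (character \<xi>) = (\<integral>x. indicator torus x *\<^sub>R character \<xi> x \<partial>lebesgue)"
    by (subst integral_restrict_space) auto
  also have "\<dots> = (\<integral>x. (\<Prod>b\<in>Basis. g b (x \<bullet> b)) \<partial>lborel)"
    unfolding eq by (intro integral_completion) measurable
  also have "\<dots> = (\<integral>x. (\<Prod>b\<in>Basis. g b (x b)) \<partial>(\<Pi>\<^sub>M b\<in>(Basis::(real^'n) set). lborel))"
    by (subst lborel_eq, subst integral_distr) (auto intro!: Bochner_Integration.integral_cong prod.cong)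
  also have "\<dots> = (\<Prod>b\<in>(Basis::(real^'n) set). integral\<^sup>L lborel (g b))"
    by (intro product_integral_prod g_int) auto
  also have "\<dots> = 0"
    using integral_cis_unit_interval[OF i(1,2)] i(3) by (auto simp: g_def[abs_def] prod_zero_iff)
  finally show ?thesis using False by simp
qed

lemma fourier_coeff_one: "fourier_coeff (\<lambda>x. 1) \<xi> = (if \<xi> = 0 then 1 else 0)"
  using integral_character[of "- \<xi>"] by (simp add: fourier_coeff_character)

lemma torus_integrable_bounded:
  fixes F :: "real^'n \<Rightarrow> 'b::{banach, second_countable_topology}"
  assumes "F \<in> borel_measurable (lebesgue_on torus)" "\<And>x. x \<in> torus \<Longrightarrow> norm (F x) \<le> B"
  shows "integrable (lebesgue_on torus) F"
  using assms by (intro torus.integrable_const_bound[of _ B]) auto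

section \<open>Trigonometric polynomials with prescribed spectrum\<close>

inductive_set trig :: "(int^'n) set \<Rightarrow> (real^'n \<Rightarrow> complex) set" for A where
  trig_zero: "(\<lambda>x. 0) \<in> trig A"
| trig_step: "p \<in> trig A \<Longrightarrow> \<xi> \<in> A \<Longrightarrow> (\<lambda>x. p x + c * character \<xi> x) \<in> trig A"

text \<open>The inductive presentation lets frequencies repeat, so a sum is formed by appending
  terms, without collecting coefficients.\<close>

lemma trig_add:
  assumes "p \<in> trig A" "q \<in> trig A"
  shows "(\<lambda>x. p x + q x) \<in> trig A"
  using assms(2)
proof induction
  case trig_zero
  then show ?case using assms(1) by simp
next
  case (trig_step q \<xi> c)
  then show ?case using trig.trig_step[of "\<lambda>x. p x + q x" A \<xi> c] by (simp add: add.assoc)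
qed

lemma trig_character: "\<xi> \<in> A \<Longrightarrow> (\<lambda>x. c * character \<xi> x) \<in> trig A"
  using trig_step[OF trig_zero, of \<xi> A c] by simp

text \<open>Frequencies add under multiplication. Three separate sets cover scalars (spectrum
  \<open>{0}\<close>), the full lattice and additively closed sets alike.\<close>

lemma trig_mult:
  assumes "p \<in> trig A" "q \<in> trig B" and sub: "\<And>\<xi> \<eta>. \<xi> \<in> A \<Longrightarrow> \<eta> \<in> B \<Longrightarrow> \<xi> + \<eta> \<in> C"
  shows "(\<lambda>x. p x * q x) \<in> trig C"
  using assms(1)
proof induction
  case trig_zero
  then show ?case by (simp add: trig.trig_zero)
next
  case (trig_step p \<xi> c)
  have "(\<lambda>x. (c * character \<xi> x) * q x) \<in> trig C"
    using assms(2)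
  proof induction
    case trig_zero
    then show ?case by (simp add: trig.trig_zero)
  next
    case (trig_step q \<eta> d)
    then show ?case
      using trig.trig_step[of _ C "\<xi> + \<eta>" "c * d"] sub[OF \<open>\<xi> \<in> A\<close>]
      by (simp add: algebra_simps character_add)
  qed
  from trig_add[OF trig_step.IH this] show ?case by (simp add: algebra_simps)
qed

lemma trig_cmult: "p \<in> trig A \<Longrightarrow> (\<lambda>x. c * p x) \<in> trig A"
  using trig_mult[OF trig_character[of 0 "{0}" c], of p A A] by simp

lemma trig_power:
  assumes "p \<in> trig A" "\<And>\<xi> \<eta>. \<xi> \<in> A \<Longrightarrow> \<eta> \<in> A \<Longrightarrow> \<xi> + \<eta> \<in> A"
  shows "(\<lambda>x. p x ^ Suc n) \<in> trig A"
proof (induction n)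
  case (Suc n)
  then show ?case using trig_mult[OF assms(1) Suc assms(2)] by simp
qed (use assms in simp)

lemma trig_cnj: "p \<in> trig UNIV \<Longrightarrow> (\<lambda>x. cnj (p x)) \<in> trig UNIV"
proof (induction rule: trig.induct)
  case (trig_step p \<xi> c)
  then show ?case using trig.trig_step[of _ UNIV "- \<xi>" "cnj c"] by (simp add: character_minus)
qed (simp add: trig_zero)

lemma trig_bounded: "p \<in> trig A \<Longrightarrow> \<exists>B. \<forall>x. cmod (p x) \<le> B"
proof (induction rule: trig.induct)
  case (trig_step p \<xi> c)
  then obtain B where "\<forall>x. cmod (p x) \<le> B" by auto
  then have "cmod (p x + c * character \<xi> x) \<le> B + cmod c" for x
    using norm_triangle_le[of "p x" "c * character \<xi> x" "B + cmod c"] by (simp add: norm_mult)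
  then show ?case by blast
qed auto

lemma continuous_on_trig: "p \<in> trig A \<Longrightarrow> continuous_on X p"
  by (induction rule: trig.induct) (auto intro!: continuous_intros)

lemma trig_measurable: "p \<in> trig A \<Longrightarrow> p \<in> borel_measurable (lebesgue_on torus)"
  by (intro continuous_imp_measurable_on_sets_lebesgue continuous_on_trig) auto

text \<open>A term with frequency in \<open>S\<close> has the same real part as its conjugate, whose
  frequency is the opposite one; frequency 0 only changes the constant.\<close>

lemma trig_Re_half_space:
  assumes "half_space S" "p \<in> trig UNIV"
  shows "\<exists>c. \<exists>q\<in>trig (uminus ` S). \<forall>x. Re (p x) = c + Re (q x)"
  using assms(2)
proof induction
  case trig_zero
  then show ?case by (intro exI[of _ 0] bexI[of _ "\<lambda>x. 0"]) (auto simp: trig.trig_zero)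
next
  case (trig_step p \<xi> c)
  then obtain a q where q: "q \<in> trig (uminus ` S)" "\<And>x. Re (p x) = a + Re (q x)" by auto
  consider "\<xi> = 0" | "\<xi> \<in> uminus ` S" | "\<xi> \<in> S"
    using assms(1) by (force simp: half_space_def)
  then show ?case
  proof cases
    case 1
    then show ?thesis using q by (intro exI[of _ "a + Re c"] bexI[of _ q]) auto
  next
    case 2
    then show ?thesis
      using q trig.trig_step[OF q(1) 2, of c] by (intro exI[of _ a] bexI[of _ "\<lambda>x. q x + c * character \<xi> x"]) auto
  next
    case 3
    then have "- \<xi> \<in> uminus ` S" by auto
    from trig.trig_step[OF q(1) this, of "cnj c"] show ?thesis
      using q by (intro exI[of _ a] bexI[of _ "\<lambda>x. q x + cnj c * character (- \<xi>) x"]) (auto simp: character_minus)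
  qed
qed

section \<open>Functions with spectrum off a half-space, tested against trigonometric
  polynomials\<close>

lemma integral_mult_trig:
  fixes F :: "real^'n \<Rightarrow> complex"
  assumes F: "F \<in> borel_measurable (lebesgue_on torus)" "\<And>x. x \<in> torus \<Longrightarrow> cmod (F x) \<le> B"
    and "\<And>\<xi>. \<xi> \<in> A \<Longrightarrow> fourier_coeff F (- \<xi>) = 0"
    and "p \<in> trig A"
  shows "(\<integral>x. F x * p x \<partial>lebesgue_on torus) = 0"
  using assms(4)
proof induction
  case trig_zero
  then show ?case by simp
next
  case (trig_step p \<xi> c)
  obtain C where C: "\<And>x. cmod (p x) \<le> C" using trig_bounded[OF trig_step.hyps(1)] by auto
  note [measurable] = F(1) trig_measurable[OF trig_step.hyps(1)]
  have B: "B \<ge> 0" if "x \<in> torus" for x :: "real^'n" using F(2)[OF that] norm_ge_zero order_trans by blast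
  have "integrable (lebesgue_on torus) (\<lambda>x. F x * p x)"
    using F(2) C B by (intro torus_integrable_bounded[of _ "B * C"]) (auto simp: norm_mult intro!: mult_mono)
  moreover have "integrable (lebesgue_on torus) (\<lambda>x. F x * character \<xi> x)"
    using F(2) by (intro torus_integrable_bounded[of _ "B"]) (auto simp: norm_mult)
  ultimately show ?case
    using assms(3)[OF \<open>\<xi> \<in> A\<close>] trig_step.IH
    by (simp add: fourier_coeff_character algebra_simps)
qed

text \<open>In the exponential series every positive power of \<open>q\<close> has spectrum in
  \<open>A\<close> and integrates to 0 against \<open>F\<close>, so only the term
  \<open>n = 0\<close> survives. The summable majorant \<open>B * (C ^ n / fact n)\<close> justifies
  integrating termwise.\<close>

lemma integral_mult_exp_trig:
  fixes F :: "real^'n \<Rightarrow> complex"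
  assumes F: "F \<in> borel_measurable (lebesgue_on torus)" "\<And>x. x \<in> torus \<Longrightarrow> cmod (F x) \<le> B"
    and van: "\<And>\<xi>. \<xi> \<in> A \<Longrightarrow> fourier_coeff F (- \<xi>) = 0"
    and A: "\<And>\<xi> \<eta>. \<xi> \<in> A \<Longrightarrow> \<eta> \<in> A \<Longrightarrow> \<xi> + \<eta> \<in> A"
    and q: "q \<in> trig A"
  shows "(\<integral>x. F x * exp (q x) \<partial>lebesgue_on torus) = (\<integral>x. F x \<partial>lebesgue_on torus)"
proof -
  obtain C where C: "\<And>x. cmod (q x) \<le> C" using trig_bounded[OF q] by auto
  then have C0: "C \<ge> 0" using norm_ge_zero order_trans by blast
  note [measurable] = F(1) trig_measurable[OF q]
  have B: "B \<ge> 0"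
  proof -
    have "(0::real^'n) \<in> torus" by (simp add: mem_torus)
    then show ?thesis using F(2) norm_ge_zero order_trans by blast
  qed
  define h where "h n x = F x * (q x ^ n /\<^sub>R fact n)" for n x
  have hb: "cmod (h n x) \<le> B * (C ^ n / fact n)" if "x \<in> torus" for n x
  proof -
    have "cmod (F x) * (cmod (q x) ^ n / fact n) \<le> B * (C ^ n / fact n)"
      using F(2)[OF that] C[of x] B by (intro mult_mono divide_right_mono power_mono) auto
    then show ?thesis by (simp add: h_def norm_mult norm_power divide_inverse mult.commute)
  qed
  have summ: "summable (\<lambda>n. B * (C ^ n / fact n))"
    using summable_exp[of C] by (intro summable_mult) (simp add: divide_inverse mult.commute)
  have [measurable]: "h n \<in> borel_measurable (lebesgue_on torus)" for n
    unfolding h_def by measurable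
  have int: "integrable (lebesgue_on torus) (h n)" for n
    using hb by (intro torus_integrable_bounded) auto
  have "(\<lambda>n. integral\<^sup>L (lebesgue_on torus) (h n)) sums (\<integral>x. (\<Sum>n. h n x) \<partial>lebesgue_on torus)"
  proof (rule sums_integral[OF int])
    show "AE x in lebesgue_on torus. summable (\<lambda>n. norm (h n x))"
      using hb by (intro AE_I2 summable_comparison_test'[OF summ]) auto
    show "summable (\<lambda>n. \<integral>x. norm (h n x) \<partial>lebesgue_on torus)"
    proof (rule summable_comparison_test'[OF summ])
      fix n
      have "(\<integral>x. norm (h n x) \<partial>lebesgue_on torus) \<le> (\<integral>x. B * (C ^ n / fact n) \<partial>lebesgue_on (torus::(real^'n) set))"
        using int hb by (intro integral_mono) auto
      then show "norm (\<integral>x. norm (h n x) \<partial>lebesgue_on torus) \<le> B * (C ^ n / fact n)"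
        by simp
    qed
  qed
  moreover have "(\<Sum>n. h n x) = F x * exp (q x)" for x
    using sums_mult[OF exp_converges[of "q x"], of "F x"] by (simp add: h_def sums_iff)
  moreover have "integral\<^sup>L (lebesgue_on torus) (h n) = (if n = 0 then integral\<^sup>L (lebesgue_on torus) F else 0)" for n
  proof (cases n)
    case (Suc m)
    have "(\<lambda>x. q x ^ n /\<^sub>R fact n) \<in> trig A"
      using trig_cmult[OF trig_power[OF q A, of m], of "inverse (fact n)"] Suc by (simp add: scaleR_conv_of_real)
    from integral_mult_trig[OF F van this] have "integral\<^sup>L (lebesgue_on torus) (h n) = 0"
      by (simp only: h_def[abs_def])
    then show ?thesis using Suc by simp
  qed (simp add: h_def[abs_def])
  ultimately show ?thesis
    using sums_single[of 0 "\<lambda>n. integral\<^sup>L (lebesgue_on torus) F"] by (simp add: sums_unique2)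
qed

text \<open>A variational form of the Jensen inequality: if \<open>Re (p x)\<close> is close to the
  logarithm of \<open>cmod (F x)\<close>, the last integral is close to at most 1. With
  \<open>Re p = c + Re q\<close>, the factor \<open>exp (- q)\<close> preserves the mean of
  \<open>F\<close>, and \<open>c\<close> is the mean of \<open>Re p\<close>.\<close>

lemma jensen_trig:
  fixes F :: "real^'n \<Rightarrow> complex"
  assumes S: "half_space S"
    and F: "F \<in> borel_measurable (lebesgue_on torus)" "\<And>x. x \<in> torus \<Longrightarrow> cmod (F x) \<le> B"
    and van: "\<And>\<xi>. \<xi> \<in> S \<Longrightarrow> fourier_coeff F \<xi> = 0"
    and p: "p \<in> trig UNIV"
  shows "cmod (integral\<^sup>L (lebesgue_on torus) F) \<le>
    exp (\<integral>x. Re (p x) \<partial>lebesgue_on torus) * (\<integral>x. cmod (F x) * exp (- Re (p x)) \<partial>lebesgue_on torus)"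
proof -
  let ?H = "uminus ` S"
  have H: "\<xi> + \<eta> \<in> ?H" if "\<xi> \<in> ?H" "\<eta> \<in> ?H" for \<xi> \<eta>
  proof -
    from that obtain a b where "\<xi> = - a" "\<eta> = - b" "a \<in> S" "b \<in> S" by auto
    moreover from this have "a + b \<in> S" using S by (simp add: half_space_def)
    ultimately show ?thesis by (intro image_eqI[of _ _ "a + b"]) auto
  qed
  obtain c q where q: "q \<in> trig ?H" "\<And>x. Re (p x) = c + Re (q x)"
    using trig_Re_half_space[OF S p] by auto
  obtain C where C: "\<And>x. cmod (q x) \<le> C" using trig_bounded[OF q(1)] by auto
  note [measurable] = F(1) trig_measurable[OF q(1)]
  have qint: "integrable (lebesgue_on torus) q"
    using C by (intro torus_integrable_bounded) auto
  have "integral\<^sup>L (lebesgue_on torus) q = 0"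
  proof -
    \<comment> \<open>The constant function 1 has no frequency other than 0, which is missing from
      \<open>?H\<close>; hence \<open>q\<close> has mean 0.\<close>
    have "fourier_coeff (\<lambda>x. 1) (- \<xi>) = 0" if "\<xi> \<in> ?H" for \<xi>
      using that S by (auto simp: fourier_coeff_one half_space_def)
    from integral_mult_trig[of "\<lambda>x. 1" 1, OF _ _ this q(1)] show ?thesis by simp
  qed
  then have c: "(\<integral>x. Re (p x) \<partial>lebesgue_on torus) = c"
    using qint by (simp add: q(2) integral_Re)
  have minus_q: "(\<lambda>x. - q x) \<in> trig ?H" using trig_cmult[OF q(1), of "-1"] by simp
  have vanH: "fourier_coeff F (- \<xi>) = 0" if "\<xi> \<in> ?H" for \<xi>
    using that van by auto
  have "cmod (integral\<^sup>L (lebesgue_on torus) F) = cmod (\<integral>x. F x * exp (- q x) \<partial>lebesgue_on torus)"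
    using integral_mult_exp_trig[OF F vanH H minus_q] by simp
  also have "\<dots> \<le> (\<integral>x. cmod (F x * exp (- q x)) \<partial>lebesgue_on torus)"
    by (rule integral_norm_bound)
  also have "\<dots> = (\<integral>x. exp c * (cmod (F x) * exp (- Re (p x))) \<partial>lebesgue_on torus)"
  proof -
    have "exp (- Re (q x)) = exp c * exp (- Re (p x))" for x
      by (simp add: q(2) exp_add[symmetric])
    then show ?thesis by (simp add: norm_mult mult.left_commute)
  qed
  finally show ?thesis by (simp add: c)
qed

section \<open>Bounded trigonometric approximation and the Jensen inequality\<close>

lemma trig_Re_separates:
  assumes "0 < \<delta>" "x \<in> cbox (\<delta> *\<^sub>R 1) ((1 - \<delta>) *\<^sub>R 1)" "y \<in> cbox (\<delta> *\<^sub>R 1) ((1 - \<delta>) *\<^sub>R 1)" "x \<noteq> y"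
  shows "\<exists>p\<in>trig UNIV. Re (p x) \<noteq> Re (p y)"
proof (rule ccontr)
  assume contra: "\<not> ?thesis"
  obtain i where i: "x $ i \<noteq> y $ i" using \<open>x \<noteq> y\<close> by (auto simp: vec_eq_iff)
  have dot: "lattice_dot (axis i 1) z = z $ i" for z :: "real^'a"
    by (simp add: lattice_dot_def axis_def if_distrib if_distribR cong: if_cong)
  have "Re (c * character (axis i 1) x) = Re (c * character (axis i 1) y)" for c
    using contra trig_character[of "axis i 1" UNIV c] by auto
  \<comment> \<open>The factors 1 and \<open>- \<i>\<close> turn the real part into the cosine and
    the sine, so the coordinates \<open>i\<close> of both points agree modulo 1.\<close>
  from this[of 1] this[of "- \<i>"] have "cis (2 * pi * x $ i) = cis (2 * pi * y $ i)"
    by (simp add: complex_eq_iff character_def dot)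
  then have "exp (\<i> * of_real (2 * pi * x $ i)) = exp (\<i> * of_real (2 * pi * y $ i))"
    by (simp add: cis_conv_exp)
  then obtain n :: int where "\<i> * of_real (2 * pi * x $ i) = \<i> * of_real (2 * pi * y $ i) + (2 * of_int n * pi) * \<i>"
    by (auto simp: exp_eq)
  then have "2 * pi * x $ i = 2 * pi * y $ i + 2 * of_int n * pi"
    by (simp add: complex_eq_iff)
  then have "2 * pi * (x $ i - y $ i) = 2 * pi * of_int n" by (simp add: algebra_simps)
  then have "x $ i - y $ i = of_int n" by simp
  \<comment> \<open>Both coordinates lie between \<delta> and \<open>1 - \<delta>\<close>, too close
    for a nonzero integer difference.\<close>
  moreover have "\<bar>x $ i - y $ i\<bar> < 1"
    using assms(1-3) by (auto simp: mem_box_cart abs_if) (smt (verit))+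
  ultimately have "\<bar>of_int n :: real\<bar> < of_int 1" by simp
  then have "n = 0" by linarith
  with \<open>x $ i - y $ i = of_int n\<close> i show False by simp
qed

text \<open>Averaging \<open>q\<close> with its conjugate gives a real factor, which can be pulled
  out of the real part. Thus real parts of trigonometric polynomials form an algebra, as
  Stone--Weierstrass requires.\<close>

lemma trig_Re_mult:
  assumes "p \<in> trig UNIV" "q \<in> trig UNIV"
  shows "\<exists>r\<in>trig UNIV. \<forall>x. Re (r x) = Re (p x) * Re (q x)"
proof
  show "(\<lambda>x. p x * (1/2 * (q x + cnj (q x)))) \<in> trig UNIV"
    using assms by (intro trig_mult[of p UNIV _ UNIV] trig_cmult trig_add trig_cnj) auto
  show "\<forall>x. Re (p x * (1/2 * (q x + cnj (q x)))) = Re (p x) * Re (q x)"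
    by (simp add: complex_add_cnj)
qed

lemma trig_Re_polynomial:
  assumes "real_polynomial_function g" "p \<in> trig UNIV"
  shows "\<exists>r\<in>trig UNIV. \<forall>x. Re (r x) = g (Re (p x))"
  using assms(1)
proof (induction rule: real_polynomial_function.induct)
  case (linear f)
  then obtain c where "f = (\<lambda>x. x * c)" using real_bounded_linear by blast
  then show ?case using trig_cmult[OF assms(2), of "of_real c"] by (intro bexI[of _ "\<lambda>x. of_real c * p x"]) auto
next
  case (const c)
  then show ?case using trig_character[of 0 UNIV "of_real c"] by (intro bexI[of _ "\<lambda>x. of_real c"]) auto
next
  case (add f g)
  then obtain r s where rs: "r \<in> trig UNIV" "\<forall>x. Re (r x) = f (Re (p x))"
      "s \<in> trig UNIV" "\<forall>x. Re (s x) = g (Re (p x))"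
    by auto
  then show ?case by (intro bexI[OF _ trig_add[OF rs(1,3)]]) auto
next
  case (mult f g)
  then obtain r s where rs: "r \<in> trig UNIV" "\<forall>x. Re (r x) = f (Re (p x))"
      "s \<in> trig UNIV" "\<forall>x. Re (s x) = g (Re (p x))"
    by auto
  then show ?case using trig_Re_mult[OF rs(1,3)] by auto
qed

text \<open>Characters do not separate opposite faces of the cube, so Stone--Weierstrass only applies on a
  smaller cube; outside of it the approximant is kept bounded by composing it with a polynomial
  that approximates the truncation to \<open>[-B, B]\<close>.\<close>

lemma trig_approx_continuous:
  fixes g :: "real^'n \<Rightarrow> real"
  assumes g: "continuous_on UNIV g" "\<And>x. \<bar>g x\<bar> \<le> B" and "0 < \<delta>" "0 < e" "B \<ge> 0"
  shows "\<exists>p\<in>trig UNIV. (\<forall>x. \<bar>Re (p x)\<bar> \<le> B + e) \<and>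
    (\<forall>x\<in>cbox (\<delta> *\<^sub>R 1) ((1 - \<delta>) *\<^sub>R 1). \<bar>Re (p x) - g x\<bar> < e)"
proof -
  let ?K = "cbox (\<delta> *\<^sub>R 1) ((1 - \<delta>) *\<^sub>R 1) :: (real^'n) set"
  let ?R = "{\<lambda>x. Re (p x) | p. p \<in> trig UNIV} :: (real^'n \<Rightarrow> real) set"
  interpret function_ring_on ?R ?K
  proof
    show "compact ?K" by simp
    show "continuous_on ?K f" if "f \<in> ?R" for f
      using that by (auto intro!: continuous_intros continuous_on_trig)
    show "(\<lambda>x. f x + h x) \<in> ?R" if "f \<in> ?R" "h \<in> ?R" for f h
    proof -
      from that obtain p q where "f = (\<lambda>x. Re (p x))" "h = (\<lambda>x. Re (q x))" "p \<in> trig UNIV" "q \<in> trig UNIV"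
        by auto
      with trig_add[of p UNIV q] show ?thesis by (auto intro!: exI[of _ "\<lambda>x. p x + q x"])
    qed
    show "(\<lambda>x. f x * h x) \<in> ?R" if "f \<in> ?R" "h \<in> ?R" for f h
    proof -
      from that obtain p q where pq: "f = (\<lambda>x. Re (p x))" "h = (\<lambda>x. Re (q x))" "p \<in> trig UNIV" "q \<in> trig UNIV"
        by auto
      then obtain r where "r \<in> trig UNIV" "\<forall>x. Re (r x) = Re (p x) * Re (q x)"
        using trig_Re_mult by blast
      with pq show ?thesis by (auto intro!: exI[of _ r])
    qed
    show "(\<lambda>_. c) \<in> ?R" for c
      using trig_character[of 0 UNIV "of_real c"] by (auto intro!: exI[of _ "\<lambda>x. of_real c"])
    show "\<exists>f\<in>?R. f x \<noteq> f y" if "x \<in> ?K" "y \<in> ?K" "x \<noteq> y" for x y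
      using trig_Re_separates[OF \<open>0 < \<delta>\<close> that] by auto
  qed
  have "continuous_on ?K g" using g(1) continuous_on_subset by blast
  from Stone_Weierstrass_basic[OF this, of "e/2"] obtain p where
    p: "p \<in> trig UNIV" "\<And>x. x \<in> ?K \<Longrightarrow> \<bar>g x - Re (p x)\<bar> < e/2"
    using \<open>0 < e\<close> by auto
  obtain M where M: "\<And>x. cmod (p x) \<le> M" using trig_bounded[OF p(1)] by auto
  define cl where "cl t = max (- B) (min B t)" for t
  have "continuous_on {-M..M} cl" unfolding cl_def by (intro continuous_intros)
  from Stone_Weierstrass_real_polynomial_function[OF _ this, of "e/2"] obtain h where
    h: "real_polynomial_function h" "\<And>t. t \<in> {-M..M} \<Longrightarrow> \<bar>cl t - h t\<bar> < e/2"
    using \<open>0 < e\<close> by auto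
  obtain r where r: "r \<in> trig UNIV" "\<And>x. Re (r x) = h (Re (p x))"
    using trig_Re_polynomial[OF h(1) p(1)] by auto
  have "Re (p x) \<in> {-M..M}" for x
    using abs_Re_le_cmod[of "p x"] M[of x] by auto
  with h(2) r(2) have rcl: "\<bar>cl (Re (p x)) - Re (r x)\<bar> < e/2" for x by simp
  show ?thesis
  proof (intro bexI[OF _ r(1)] conjI allI ballI)
    show "\<bar>Re (r x)\<bar> \<le> B + e" for x
      using rcl[of x] \<open>0 < e\<close> \<open>B \<ge> 0\<close> unfolding cl_def by linarith
    \<comment> \<open>Truncation is 1-Lipschitz and fixes \<open>g x\<close>, so the two errors
      below \<open>e/2\<close> simply add.\<close>
    show "\<bar>Re (r x) - g x\<bar> < e" if "x \<in> ?K" for x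
      using rcl[of x] p(2)[OF that] g(2)[of x] \<open>0 < e\<close> unfolding cl_def by linarith
  qed
qed

text \<open>A measurable function is an almost everywhere limit of continuous ones; these are
  truncated and approximated within \<open>e n\<close> on the cube shrunk by \<open>e n\<close>. An
  interior point lies in all but finitely many of these cubes, and the boundary is null. The uniform
  bound is there for dominated convergence.\<close>

lemma trig_approx_measurable:
  fixes u :: "real^'n \<Rightarrow> real"
  assumes u: "u \<in> borel_measurable (lebesgue_on torus)" "\<And>x. x \<in> torus \<Longrightarrow> \<bar>u x\<bar> \<le> B" and "B \<ge> 0"
  shows "\<exists>p. (\<forall>n. p n \<in> trig UNIV \<and> (\<forall>x. \<bar>Re (p n x)\<bar> \<le> B + 1)) \<and>
    (AE x in lebesgue_on torus. (\<lambda>n. Re (p n x)) \<longlonglongrightarrow> u x)"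
proof -
  have "u measurable_on torus" using u(1) by (simp add: measurable_on_iff_borel_measurable)
  then obtain N g where N: "negligible N" and g: "\<And>n. continuous_on UNIV (g n)"
    "\<And>x. x \<notin> N \<Longrightarrow> (\<lambda>n. g n x) \<longlonglongrightarrow> (if x \<in> torus then u x else 0)"
    unfolding measurable_on_def by blast
  define cl where "cl t = max (- B) (min B t)" for t
  define e where "e n = inverse (real (Suc n))" for n
  define K where "K n = (cbox (e n *\<^sub>R 1) ((1 - e n) *\<^sub>R 1) :: (real^'n) set)" for n
  have e: "0 < e n" "e n \<le> 1" for n by (auto simp: e_def field_simps)
  have e0: "e \<longlonglongrightarrow> 0" unfolding e_def by (rule LIMSEQ_inverse_real_of_nat)
  have "\<exists>p\<in>trig UNIV. (\<forall>x. \<bar>Re (p x)\<bar> \<le> B + e n) \<and> (\<forall>x\<in>K n. \<bar>Re (p x) - cl (g n x)\<bar> < e n)" for n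
    unfolding K_def using g(1) \<open>B \<ge> 0\<close> e
    by (intro trig_approx_continuous) (auto simp: cl_def intro!: continuous_intros)
  then obtain p where p: "\<And>n. p n \<in> trig UNIV" "\<And>n x. \<bar>Re (p n x)\<bar> \<le> B + e n"
      "\<And>n x. x \<in> K n \<Longrightarrow> \<bar>Re (p n x) - cl (g n x)\<bar> < e n"
    by metis
  have lim: "(\<lambda>n. Re (p n x)) \<longlonglongrightarrow> u x" if "x \<in> box 0 1" "x \<notin> N" for x
  proof -
    have xt: "x \<in> torus" using that(1) box_subset_cbox by (auto simp: torus_def)
    have "(\<lambda>n. cl (g n x)) \<longlonglongrightarrow> cl (u x)"
      unfolding cl_def using g(2)[OF that(2)] xt by (intro tendsto_intros) auto
    also have "cl (u x) = u x" using u(2)[OF xt] by (auto simp: cl_def)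
    finally have 1: "(\<lambda>n. cl (g n x)) \<longlonglongrightarrow> u x" .
    have "\<forall>\<^sub>F n in sequentially. \<forall>i\<in>UNIV. e n < x $ i \<and> e n < 1 - x $ i"
      using that(1) by (intro eventually_ball_finite ballI eventually_conj order_tendstoD(2)[OF e0]) (auto simp: mem_box_cart)
    then have "\<forall>\<^sub>F n in sequentially. x \<in> K n"
      by eventually_elim (auto simp: K_def mem_box_cart; smt (verit, best))
    then have "\<forall>\<^sub>F n in sequentially. norm (Re (p n x) - cl (g n x)) \<le> e n"
      by eventually_elim (use p(3) less_imp_le in auto)
    then have "(\<lambda>n. Re (p n x) - cl (g n x)) \<longlonglongrightarrow> 0"
      by (rule Lim_null_comparison[OF _ e0])
    from tendsto_add[OF this 1] show ?thesis by simp
  qed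
  have "negligible (N \<union> (cbox 0 1 - box 0 1))"
    using N negligible_frontier_interval by (intro negligible_Un) auto
  then have null: "N \<union> (cbox 0 1 - box 0 1) \<in> null_sets lebesgue"
    by (simp add: negligible_iff_null_sets)
  have "AE x in lebesgue. x \<in> torus \<longrightarrow> (\<lambda>n. Re (p n x)) \<longlonglongrightarrow> u x"
    using AE_not_in[OF null] by eventually_elim (use lim in \<open>auto simp: torus_def\<close>)
  then have "AE x in lebesgue_on torus. (\<lambda>n. Re (p n x)) \<longlonglongrightarrow> u x"
    by (simp add: AE_restrict_space_iff)
  moreover have "\<bar>Re (p n x)\<bar> \<le> B + 1" for n x
    using p(2)[of n x] e(2)[of n] by linarith
  ultimately show ?thesis using p(1) by blast
qed

text \<open>Adding \<epsilon> keeps the logarithm \<open>u\<close> bounded, hence approximable by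
  the previous lemma. In the limit of \<open>jensen_trig\<close> the second integrand becomes
  \<open>cmod (F x) / (cmod (F x) + \<epsilon>)\<close>, which is at most 1.\<close>

lemma jensen_half_space:
  fixes F :: "real^'n \<Rightarrow> complex"
  assumes S: "half_space S"
    and F: "F \<in> borel_measurable (lebesgue_on torus)" "\<And>x. x \<in> torus \<Longrightarrow> cmod (F x) \<le> B"
    and van: "\<And>\<xi>. \<xi> \<in> S \<Longrightarrow> fourier_coeff F \<xi> = 0"
    and \<epsilon>: "0 < \<epsilon>"
  shows "cmod (integral\<^sup>L (lebesgue_on torus) F) \<le> exp (\<integral>x. ln (cmod (F x) + \<epsilon>) \<partial>lebesgue_on torus)"
proof -
  let ?I = "integral\<^sup>L (lebesgue_on (torus::(real^'n) set))"
  define u where "u x = ln (cmod (F x) + \<epsilon>)" for x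
  define C where "C = max \<bar>ln \<epsilon>\<bar> \<bar>ln (B + \<epsilon>)\<bar>"
  note [measurable] = F(1)
  have pos: "0 < cmod (F x) + \<epsilon>" for x using \<epsilon> by (simp add: add_nonneg_pos)
  have B: "B \<ge> 0"
    using order_trans[OF norm_ge_zero F(2)[of 0]] by (simp add: mem_torus)
  have u_meas: "u \<in> borel_measurable (lebesgue_on torus)" unfolding u_def by measurable
  have uC: "\<bar>u x\<bar> \<le> C" if "x \<in> torus" for x
  proof -
    have "ln \<epsilon> \<le> u x" "u x \<le> ln (B + \<epsilon>)"
      using F(2)[OF that] \<epsilon> pos[of x] B by (auto simp: u_def)
    then show ?thesis unfolding C_def by linarith
  qed
  have "C \<ge> 0" by (simp add: C_def)
  from trig_approx_measurable[OF u_meas uC this] obtain p where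
    p: "\<And>n. p n \<in> trig UNIV" "\<And>n x. \<bar>Re (p n x)\<bar> \<le> C + 1"
    and lim: "AE x in lebesgue_on torus. (\<lambda>n. Re (p n x)) \<longlonglongrightarrow> u x"
    by blast
  note [measurable] = u_meas trig_measurable[OF p(1)]
  have 1: "(\<lambda>n. ?I (\<lambda>x. Re (p n x))) \<longlonglongrightarrow> ?I u"
    using p(2) lim
    by (intro integral_dominated_convergence[where w = "\<lambda>_. C + 1"]) auto
  have 2: "(\<lambda>n. ?I (\<lambda>x. cmod (F x) * exp (- Re (p n x)))) \<longlonglongrightarrow> ?I (\<lambda>x. cmod (F x) * exp (- u x))"
  proof (intro integral_dominated_convergence[where w = "\<lambda>_. B * exp (C + 1)"])
    show "AE x in lebesgue_on torus. (\<lambda>n. cmod (F x) * exp (- Re (p n x))) \<longlonglongrightarrow> cmod (F x) * exp (- u x)"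
      using lim by eventually_elim (intro tendsto_intros)
    show "AE x in lebesgue_on torus. norm (cmod (F x) * exp (- Re (p n x))) \<le> B * exp (C + 1)" for n
    proof (intro AE_I2)
      fix x :: "real^'n" assume "x \<in> space (lebesgue_on torus)"
      then have "cmod (F x) \<le> B" using F(2) by simp
      moreover have "- Re (p n x) \<le> C + 1" using p(2)[of n x] by linarith
      ultimately have "cmod (F x) * exp (- Re (p n x)) \<le> B * exp (C + 1)"
        using B by (intro mult_mono) auto
      then show "norm (cmod (F x) * exp (- Re (p n x))) \<le> B * exp (C + 1)" by simp
    qed
  qed auto
  have "?I (\<lambda>x. cmod (F x) * exp (- u x)) \<le> ?I (\<lambda>x. 1)"
  proof (rule integral_mono)
    have q: "0 \<le> cmod (F x) * exp (- u x) \<and> cmod (F x) * exp (- u x) \<le> 1" for x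
      using pos[of x] \<epsilon> by (simp add: u_def exp_minus field_simps)
    then show "cmod (F x) * exp (- u x) \<le> 1" for x by simp
    show "integrable (lebesgue_on torus) (\<lambda>x. cmod (F x) * exp (- u x))"
      using q by (intro torus_integrable_bounded[of _ 1]) auto
  qed simp
  then have 3: "?I (\<lambda>x. cmod (F x) * exp (- u x)) \<le> 1" by simp
  have "cmod (?I F) \<le> exp (?I u) * ?I (\<lambda>x. cmod (F x) * exp (- u x))"
    using jensen_trig[OF S F van p(1)] by (intro LIMSEQ_le_const[OF tendsto_mult[OF tendsto_exp[OF 1] 2]]) auto
  also have "\<dots> \<le> exp (?I u) * 1" using 3 by (intro mult_left_mono) auto
  finally show ?thesis by (simp add: u_def[abs_def])
qed

section \<open>The series of the logarithmic kernel\<close>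

text \<open>Here and below the summand \<open>j = 0\<close> vanishes because \<open>1 / 0 = 0\<close>.\<close>

lemma log_series_bound:
  fixes z :: complex
  assumes "cmod z = 1" "0 < r" "r < 1"
  shows "\<bar>(\<Sum>j\<le>M. r ^ j / real j * Re (z ^ j)) + ln (cmod (1 - of_real r * z))\<bar> \<le> r ^ Suc M / (1 - r)"
proof -
  define w where "w = of_real r * z"
  have w: "cmod w = r" using assms by (simp add: w_def norm_mult)
  \<comment> \<open>The terms of the series of \<open>Ln (1 - w)\<close>; the real part of
    \<open>a n\<close> is minus the summand of the claim.\<close>
  define a where "a n = - (w ^ n) / of_nat n" for n
  have "a sums Ln (1 - w)"
    using Ln_series'[of "- w"] w assms unfolding a_def by simp
  then have "(\<lambda>n. a (n + Suc M)) sums (Ln (1 - w) - (\<Sum>n<Suc M. a n))"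
    by (rule sums_split_initial_segment)
  \<comment> \<open>Replacing the denominators by 1 leaves a geometric tail.\<close>
  moreover have "norm (a (n + Suc M)) \<le> r ^ Suc M * r ^ n" for n
  proof -
    have "norm (a (n + Suc M)) = r ^ (n + Suc M) / real (n + Suc M)"
      unfolding a_def by (simp only: norm_divide norm_minus_cancel norm_power w norm_of_nat)
    also have "\<dots> \<le> r ^ (n + Suc M) / 1"
      using assms by (intro divide_left_mono) auto
    finally show ?thesis by (simp add: power_add mult_ac)
  qed
  moreover have "(\<lambda>n. r ^ Suc M * r ^ n) sums (r ^ Suc M * (1 / (1 - r)))"
    using assms by (intro sums_mult geometric_sums) auto
  ultimately have "norm (Ln (1 - w) - (\<Sum>n<Suc M. a n)) \<le> r ^ Suc M / (1 - r)"
    using norm_suminf_le[of "\<lambda>n. a (n + Suc M)" "\<lambda>n. r ^ Suc M * r ^ n"] by (simp add: sums_iff)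
  then have "\<bar>Re (Ln (1 - w) - (\<Sum>n<Suc M. a n))\<bar> \<le> r ^ Suc M / (1 - r)"
    using abs_Re_le_cmod order_trans by blast
  moreover have "1 - w \<noteq> 0" using w assms by auto
  moreover have "Re (a n) = - (r ^ n / real n * Re (z ^ n))" for n
    by (simp add: a_def w_def power_mult_distrib flip: of_real_power)
  ultimately show ?thesis
    by (simp add: w_def lessThan_Suc_atMost sum_negf add.commute)
qed

text \<open>Trades the absolute value for an expression affine in \<open>ln t\<close>, so that a
  lower bound for the integral of the logarithm suffices. Doubled, the \<open>2 * ln 2\<close>
  becomes the \<open>ln 16\<close> of the final bound.\<close>

lemma log_slack:
  fixes t :: real
  assumes "0 < t" "t \<le> 2"
  shows "\<bar>ln t\<bar> \<le> 2 * ln 2 - ln t"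
proof -
  have "ln t \<le> ln 2" using assms by simp
  then show ?thesis by (simp add: abs_if)
qed

section \<open>The function h on E and the Jensen bound for its kernel\<close>

locale half_space_contraction =
  fixes f :: "real^'n \<Rightarrow> complex" and \<nu> :: "int^'n" and S :: "(int^'n) set"
  assumes S: "half_space S"
    and f_meas [measurable]: "f \<in> borel_measurable (lebesgue_on torus)"
    and f_le: "\<And>x. cmod (f x) \<le> 1"
    and f_van: "\<And>\<xi>. \<xi> \<in> S \<Longrightarrow> fourier_coeff f \<xi> = 0"
    and \<nu>: "\<nu> \<in> uminus ` S"
    and f_mean: "fourier_coeff f 0 \<noteq> 0"
begin

text \<open>This is h, and \<open>full_set\<close> below is E.\<close>

definition "ratio x = f x * cnj (character \<nu> x)"

definition "full_set = {x \<in> torus. cmod (f x) = 1}"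

lemma ratio_measurable [measurable]: "ratio \<in> borel_measurable (lebesgue_on torus)"
  unfolding ratio_def character_minus[symmetric] by measurable

lemma full_set_sets [measurable]: "full_set \<in> sets (lebesgue_on torus)"
proof -
  have "{x \<in> space (lebesgue_on torus). cmod (f x) = 1} \<in> sets (lebesgue_on torus)"
    by measurable
  then show ?thesis by (simp add: full_set_def)
qed

lemma norm_ratio: "x \<in> full_set \<Longrightarrow> cmod (ratio x) = 1"
  by (simp add: ratio_def full_set_def norm_mult)

lemma kernel_bounds:
  assumes "x \<in> full_set" "y \<in> full_set" "0 < r" "r < 1"
  shows "1 - r \<le> cmod (1 - of_real r * (ratio x * cnj (ratio y)))"
    and "cmod (1 - of_real r * (ratio x * cnj (ratio y))) \<le> 2"
proof -
  have "cmod (of_real r * (ratio x * cnj (ratio y))) = r"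
    using norm_ratio[OF assms(1)] norm_ratio[OF assms(2)] assms(3) by (simp add: norm_mult)
  then show "1 - r \<le> cmod (1 - of_real r * (ratio x * cnj (ratio y)))"
    "cmod (1 - of_real r * (ratio x * cnj (ratio y))) \<le> 2"
    using norm_triangle_ineq2[of 1 "of_real r * (ratio x * cnj (ratio y))"]
      norm_triangle_ineq4[of 1 "of_real r * (ratio x * cnj (ratio y))"] assms(4) by auto
qed

lemma log_kernel_integrable:
  assumes y: "y \<in> full_set" and r: "0 < r" "r < 1"
  shows "integrable (lebesgue_on torus)
    (\<lambda>x. indicator full_set x * (2 * ln 2 - ln (cmod (1 - of_real r * (ratio x * cnj (ratio y))))))"
    (is "integrable _ (\<lambda>x. _ * (_ - ln (?k x)))")
proof (rule torus_integrable_bounded)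
  show "norm (indicator full_set x * (2 * ln 2 - ln (?k x))) \<le> 2 * ln 2 + (\<bar>ln (1 - r)\<bar> + ln 2)" for x
  proof (cases "x \<in> full_set")
    case True
    have "ln (1 - r) \<le> ln (?k x)" "ln (?k x) \<le> ln 2"
      using kernel_bounds[OF True y r] r by (auto intro!: ln_mono)
    moreover have "\<bar>2 * L - l\<bar> \<le> 2 * L + (\<bar>c\<bar> + L)" if "c \<le> l" "l \<le> L" "0 \<le> L" for c l L :: real
      using that by linarith
    ultimately have "\<bar>2 * ln 2 - ln (?k x)\<bar> \<le> 2 * ln 2 + (\<bar>ln (1 - r)\<bar> + ln 2)"
      by (metis ln_ge_zero one_le_numeral)
    then show ?thesis using True by simp
  qed simp
qed measurable

lemma f_mean_le_1: "cmod (fourier_coeff f 0) \<le> 1"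
proof -
  have "cmod (integral\<^sup>L (lebesgue_on torus) f) \<le> (\<integral>x. cmod (f x) \<partial>lebesgue_on torus)"
    by (rule integral_norm_bound)
  also have "\<dots> \<le> (\<integral>x. 1 \<partial>lebesgue_on (torus::(real^'n) set))"
    using f_le by (intro integral_mono torus_integrable_bounded[of _ 1]) auto
  finally show ?thesis by (simp add: fourier_coeff_character)
qed

text \<open>The frequencies of the difference are among those of \<open>f\<close> and \<nu>, and
  \<nu> is neither in \<open>S\<close> nor 0. So its coefficients vanish on \<open>S\<close>, and
  its mean is \<open>- r * d\<close> times that of \<open>f\<close>. The constants \<open>c\<close>
  and \<open>d\<close> will be \<open>f y\<close> and \<open>character \<nu> y\<close>.\<close>

lemma jensen_difference:
  fixes c d :: complex
  assumes cd: "cmod c = 1" "cmod d = 1" and r: "0 < r" "r < 1" and \<epsilon>: "0 < \<epsilon>"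
  shows "ln (r * cmod (fourier_coeff f 0)) \<le>
    (\<integral>x. ln (cmod (c * character \<nu> x - of_real r * d * f x) + \<epsilon>) \<partial>lebesgue_on torus)"
proof -
  define F where "F x = c * character \<nu> x - of_real r * d * f x" for x
  have [measurable]: "F \<in> borel_measurable (lebesgue_on torus)" unfolding F_def by measurable
  have F_le: "cmod (F x) \<le> 2" for x
  proof -
    have "r * cmod (f x) \<le> 1 * 1" using r f_le[of x] by (intro mult_mono) auto
    then show ?thesis
      using norm_triangle_ineq4[of "c * character \<nu> x" "of_real r * d * f x"] r
      by (simp add: F_def norm_mult cd)
  qed
  have coeff: "fourier_coeff F \<xi> = c * (if \<xi> = \<nu> then 1 else 0) - of_real r * d * fourier_coeff f \<xi>" for \<xi>
  proof -
    have "integrable (lebesgue_on torus) (\<lambda>x. f x * character (- \<xi>) x)"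
      using f_le by (intro torus_integrable_bounded[of _ 1]) (auto simp: norm_mult)
    moreover have "integrable (lebesgue_on torus) (character (\<nu> - \<xi>))"
      by (intro torus_integrable_bounded[of _ 1]) auto
    moreover have "F x * character (- \<xi>) x
        = c * character (\<nu> - \<xi>) x - of_real r * d * (f x * character (- \<xi>) x)" for x
      using character_add[of \<nu> "- \<xi>" x] by (simp add: F_def algebra_simps)
    ultimately show ?thesis
      by (simp add: fourier_coeff_character integral_character)
  qed
  obtain \<mu> where \<mu>: "\<mu> \<in> S" "\<nu> = - \<mu>" using \<nu> by auto
  \<comment> \<open>Opposite elements cannot both lie in \<open>S\<close>, since their sum would be
    0.\<close>
  have add: "\<xi> + \<eta> \<noteq> 0" if "\<xi> \<in> S" "\<eta> \<in> S" for \<xi> \<eta>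
    using S that unfolding half_space_def by metis
  have "\<nu> \<notin> S" "\<nu> \<noteq> 0" using add[OF \<mu>(1), of \<nu>] \<mu> S by (auto simp: half_space_def)
  then have van: "fourier_coeff F \<xi> = 0" if "\<xi> \<in> S" for \<xi>
    using that f_van[OF that] by (auto simp: coeff)
  have mean: "integral\<^sup>L (lebesgue_on torus) F = - (of_real r * d * fourier_coeff f 0)"
    using coeff[of 0] \<open>\<nu> \<noteq> 0\<close> by (simp add: fourier_coeff_character)
  have "cmod (integral\<^sup>L (lebesgue_on torus) F) \<le> exp (\<integral>x. ln (cmod (F x) + \<epsilon>) \<partial>lebesgue_on torus)"
    by (rule jensen_half_space[OF S _ F_le van \<epsilon>]) auto
  then have "r * cmod (fourier_coeff f 0) \<le> exp (\<integral>x. ln (cmod (F x) + \<epsilon>) \<partial>lebesgue_on torus)"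
    using r by (simp add: mean norm_mult cd)
  moreover have "0 < r * cmod (fourier_coeff f 0)" using r f_mean by simp
  ultimately have "ln (r * cmod (fourier_coeff f 0)) \<le> (\<integral>x. ln (cmod (F x) + \<epsilon>) \<partial>lebesgue_on torus)"
    by (metis exp_gt_zero ln_exp ln_le_cancel_iff)
  then show ?thesis by (simp add: F_def)
qed

text \<open>On E the kernel has the modulus of the function \<open>F\<close> of
  \<open>jensen_difference\<close>. Off E the quantity
  \<open>2 * ln 2 - ln (cmod (F x) + \<epsilon>)\<close> is nonnegative, so the integral may be
  enlarged to the whole torus, where the Jensen inequality applies.\<close>

lemma log_kernel_bound:
  assumes y: "y \<in> full_set" and r: "0 < r" "r < 1"
  shows "(\<integral>x. indicator full_set x * (2 * ln 2 - ln (cmod (1 - of_real r * (ratio x * cnj (ratio y))))) \<partial>lebesgue_on torus)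
    \<le> 2 * ln 2 - ln (r * cmod (fourier_coeff f 0))" (is "?L \<le> _")
proof (rule field_le_epsilon)
  fix e :: real assume "0 < e"
  \<comment> \<open>On E, where \<open>cmod (F x)\<close> is at least \<open>1 - r\<close>, adding
    this \<epsilon> raises the logarithm by at most \<open>e\<close>; the cap 1 keeps
    \<open>cmod (F x) + \<epsilon>\<close> below 4.\<close>
  define \<epsilon> where "\<epsilon> = min 1 (e * (1 - r))"
  have \<epsilon>: "0 < \<epsilon>" "\<epsilon> \<le> 1" "\<epsilon> / (1 - r) \<le> e"
    using \<open>0 < e\<close> r by (auto simp: \<epsilon>_def field_simps)
  let ?k = "\<lambda>x. cmod (1 - of_real r * (ratio x * cnj (ratio y)))"
  define F where "F x = f y * character \<nu> x - of_real r * character \<nu> y * f x" for x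
  have [measurable]: "F \<in> borel_measurable (lebesgue_on torus)" unfolding F_def by measurable
  have fy: "cmod (f y) = 1" using y by (simp add: full_set_def)
  note k_le = kernel_bounds[OF _ y r]
  have k_eq: "?k x = cmod (F x)" for x
  proof -
    have 1: "cnj (f y) * f y = 1" "cnj (character \<nu> x) * character \<nu> x = 1"
      using complex_norm_square[of "f y"] complex_norm_square[of "character \<nu> x"] fy by (simp_all add: mult.commute)
    have "1 - of_real r * (ratio x * cnj (ratio y)) =
       (cnj (f y) * f y) * (cnj (character \<nu> x) * character \<nu> x) - of_real r * (ratio x * cnj (ratio y))"
      by (simp only: 1) simp
    also have "\<dots> = cnj (f y) * cnj (character \<nu> x) * F x"
      by (simp add: ratio_def F_def algebra_simps)
    finally show ?thesis by (simp add: norm_mult fy)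
  qed
  have F_le: "cmod (F x) \<le> 2" for x
  proof -
    have "r * cmod (f x) \<le> 1 * 1" using r f_le[of x] by (intro mult_mono) auto
    then show ?thesis
      using norm_triangle_ineq4[of "f y * character \<nu> x" "of_real r * character \<nu> y * f x"] r
      by (simp add: F_def norm_mult fy)
  qed
  have log_le: "ln (cmod (F x) + \<epsilon>) \<le> 2 * ln 2" for x
  proof -
    have "ln (cmod (F x) + \<epsilon>) \<le> ln (2 * 2)"
      using F_le[of x] \<epsilon> by (intro ln_mono) (auto intro: add_nonneg_pos)
    then show ?thesis by (subst (asm) ln_mult) auto
  qed
  have log_ge: "ln \<epsilon> \<le> ln (cmod (F x) + \<epsilon>)" for x using \<epsilon> by (intro ln_mono) auto
  have pt: "indicator full_set x * (2 * ln 2 - ln (?k x)) \<le> 2 * ln 2 - ln (cmod (F x) + \<epsilon>) + e" for x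
  proof (cases "x \<in> full_set")
    case True
    have F: "1 - r \<le> cmod (F x)" using k_le(1)[OF True] by (simp add: k_eq)
    then have F0: "0 < cmod (F x)" using r by linarith
    have "cmod (F x) + \<epsilon> = cmod (F x) * (1 + \<epsilon> / cmod (F x))" using F0 by (simp add: distrib_left)
    then have "ln (cmod (F x) + \<epsilon>) = ln (cmod (F x)) + ln (1 + \<epsilon> / cmod (F x))"
      using F0 \<epsilon> by (simp add: ln_mult_pos add_pos_pos)
    also have "ln (1 + \<epsilon> / cmod (F x)) \<le> \<epsilon> / cmod (F x)"
      using F0 \<epsilon> by (intro ln_add_one_self_le_self) auto
    also have "\<epsilon> / cmod (F x) \<le> \<epsilon> / (1 - r)" using F r \<epsilon> F0 by (intro divide_left_mono mult_pos_pos) auto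
    finally show ?thesis using True \<epsilon>(3) by (simp add: k_eq)
  next
    case False
    then show ?thesis using log_le[of x] \<open>0 < e\<close> by simp
  qed
  have int: "integrable (lebesgue_on torus) (\<lambda>x. ln (cmod (F x) + \<epsilon>))"
  proof (rule torus_integrable_bounded)
    show "norm (ln (cmod (F x) + \<epsilon>)) \<le> \<bar>ln \<epsilon>\<bar> + \<bar>2 * ln 2\<bar>" for x
      using log_le[of x] log_ge[of x] unfolding real_norm_def by linarith
  qed measurable
  have "?L \<le> (\<integral>x. 2 * ln 2 - ln (cmod (F x) + \<epsilon>) + e \<partial>lebesgue_on torus)"
  proof (rule integral_mono[OF _ _ pt])
    show "integrable (lebesgue_on torus) (\<lambda>x. indicator full_set x * (2 * ln 2 - ln (?k x)))"
      by (rule log_kernel_integrable[OF y r])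
    show "integrable (lebesgue_on torus) (\<lambda>x. 2 * ln 2 - ln (cmod (F x) + \<epsilon>) + e)"
      using int by auto
  qed
  also have "\<dots> = 2 * ln 2 - (\<integral>x. ln (cmod (F x) + \<epsilon>) \<partial>lebesgue_on torus) + e"
    using int by simp
  also have "\<dots> \<le> 2 * ln 2 - ln (r * cmod (fourier_coeff f 0)) + e"
    using jensen_difference[of "f y" "character \<nu> y" r \<epsilon>] fy r \<epsilon> by (simp add: F_def)
  finally show "?L \<le> 2 * ln 2 - ln (r * cmod (fourier_coeff f 0)) + e" .
qed


section \<open>Coefficients as moments of h, and the logarithmic energy\<close>

definition "wave k m x = indicator full_set x * (ratio x powi m * character \<nu> x powi k)" for k m :: int

lemma powi_measurable:
  assumes [measurable]: "g \<in> borel_measurable M"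
  shows "(\<lambda>x. (g x :: complex) powi m) \<in> borel_measurable M"
  unfolding power_int_def by measurable

lemma wave_measurable [measurable]: "wave k m \<in> borel_measurable (lebesgue_on torus)"
  unfolding wave_def by (intro borel_measurable_times powi_measurable) measurable

lemma norm_wave: "cmod (wave k m x) = indicator full_set x"
  using norm_ratio[of x] by (auto simp: wave_def norm_mult norm_power_int indicator_def)

text \<open>On E the conjugate character is the inverse one, so
  \<open>f x powi m * character \<nu> x powi (k - m)\<close> regroups with \<open>m\<close> only as
  the exponent of \<open>ratio x\<close>. The integrand is then extended by zero to the
  torus.\<close>

lemma bcoef_eq: "bcoef f \<nu> m k = integral\<^sup>L (lebesgue_on torus) (wave k m)"
proof -
  have "bcoef f \<nu> m k = (\<integral>x. indicator full_set x *\<^sub>R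
      (f x powi m * exp (- (2 * of_real pi * \<i> * of_int (m - k) * of_real (lattice_dot \<nu> x)))) \<partial>lebesgue)"
    unfolding bcoef_def full_set_def[symmetric] using full_set_sets
    by (subst integral_restrict_space) (auto simp: sets_restrict_space)
  also have "\<dots> = (\<integral>x. indicator torus x *\<^sub>R wave k m x \<partial>lebesgue)"
  proof (intro Bochner_Integration.integral_cong refl)
    fix x
    show "indicator full_set x *\<^sub>R
      (f x powi m * exp (- (2 * of_real pi * \<i> * of_int (m - k) * of_real (lattice_dot \<nu> x)))) =
      indicator torus x *\<^sub>R wave k m x"
    proof (cases "x \<in> full_set")
      case True
      have c: "character \<nu> x \<noteq> 0" "cnj (character \<nu> x) = inverse (character \<nu> x)"
        using norm_character[of \<nu> x] by (auto simp: character_def cis_inverse cis_cnj)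
      have "exp (- (2 * of_real pi * \<i> * of_int (m - k) * of_real (lattice_dot \<nu> x)))
          = exp (of_int (k - m) * (\<i> * of_real (2 * pi * lattice_dot \<nu> x)))"
        by (rule arg_cong[of _ _ exp]) (simp add: algebra_simps)
      also have "\<dots> = character \<nu> x powi (k - m)"
        by (simp add: character_def cis_conv_exp exp_power_int del: of_int_diff)
      finally have e: "exp (- (2 * of_real pi * \<i> * of_int (m - k) * of_real (lattice_dot \<nu> x)))
          = character \<nu> x powi (k - m)" .
      have "f x powi m * character \<nu> x powi (k - m) = ratio x powi m * character \<nu> x powi k"
      proof -
        have "ratio x powi m * character \<nu> x powi k =
            f x powi m * (inverse (character \<nu> x powi m) * character \<nu> x powi k)"
          by (simp only: ratio_def c(2) power_int_mult_distrib power_int_inverse mult.assoc)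
        then show ?thesis using c(1) by (simp add: power_int_diff divide_inverse mult.commute)
      qed
      then show ?thesis using True unfolding e by (simp add: wave_def full_set_def)
    qed (simp add: wave_def)
  qed
  also have "\<dots> = integral\<^sup>L (lebesgue_on torus) (wave k m)"
    by (subst integral_restrict_space) auto
  finally show ?thesis .
qed

lemma wave_integrable: "integrable (lebesgue_on torus) (wave k m)"
  by (intro torus_integrable_bounded[of _ 1]) (auto simp: norm_wave)

text \<open>Each product is \<open>z powi m\<close> times a factor independent of \<open>m\<close>.
  As \<open>z\<close> is unimodular, the exponents at distance \<open>j\<close> on both sides of
  \<open>N\<close> combine to \<open>z powi N\<close> times twice the real part of
  \<open>z ^ j\<close>.\<close>

lemma wave_kernel:
  assumes x: "x \<in> full_set" and y: "y \<in> full_set"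
  defines "z \<equiv> ratio x * cnj (ratio y)"
  shows "wave k (N + int j) x * cnj (wave k (N + int j) y) + wave k (N - int j) x * cnj (wave k (N - int j) y)
    = (wave k N x * cnj (wave k N y)) * of_real (2 * Re (z ^ j))"
proof -
  have z: "cmod z = 1" "z \<noteq> 0" using norm_ratio[OF x] norm_ratio[OF y] by (auto simp: z_def norm_mult)
  define W where "W = character \<nu> x powi k * cnj (character \<nu> y powi k)"
  have wave: "wave k m x * cnj (wave k m y) = z powi m * W" for m
    using x y by (simp add: wave_def z_def W_def power_int_mult_distrib)
  have sym: "z powi (N + int j) + z powi (N - int j) = z powi N * of_real (2 * Re (z ^ j))"
  proof -
    have "inverse (z ^ j) = cnj (z ^ j)"
      using z by (simp add: inverse_eq_divide divide_conv_cnj norm_power)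
    then have "z powi (N + int j) + z powi (N - int j) = z powi N * (z ^ j + cnj (z ^ j))"
      using z by (simp add: power_int_add power_int_diff divide_inverse distrib_left)
    then show ?thesis by (simp only: complex_add_cnj)
  qed
  have "z powi (N + int j) * W + z powi (N - int j) * W = z powi N * of_real (2 * Re (z ^ j)) * W"
    by (simp only: distrib_right[symmetric] sym)
  then show ?thesis by (simp only: wave mult_ac)
qed

text \<open>Writing each coefficient as an integral over \<open>x\<close> turns the sum into the
  integral of a kernel \<open>K\<close>. Up to a unimodular factor, \<open>K\<close> is twice a
  partial sum of the logarithm series, so \<open>log_series_bound\<close>, \<open>log_slack\<close>
  and \<open>log_kernel_bound\<close> apply in turn.\<close>

lemma energy_kernel_bound:
  assumes r: "0 < r" "r < 1" and y: "y \<in> torus"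
  shows "cmod (\<Sum>j\<le>M. of_real (r ^ j / real j) *
      (bcoef f \<nu> (N + int j) k * cnj (wave k (N + int j) y) + bcoef f \<nu> (N - int j) k * cnj (wave k (N - int j) y)))
    \<le> 2 * (2 * ln 2 - ln (r * cmod (fourier_coeff f 0))) + 2 * (r ^ Suc M / (1 - r))" (is "cmod ?S \<le> ?C")
proof (cases "y \<in> full_set")
  case False
  \<comment> \<open>Off E the sum is 0; the bound is nonnegative there because the mean of
    \<open>f\<close> has modulus at most 1.\<close>
  have "ln (r * cmod (fourier_coeff f 0)) \<le> ln 1"
    using r f_mean f_mean_le_1 by (intro ln_mono) (auto intro!: mult_le_one)
  then have "ln (r * cmod (fourier_coeff f 0)) \<le> 2 * ln 2"
    unfolding ln_one by (rule order_trans) simp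
  then have "0 \<le> 2 * (2 * ln 2 - ln (r * cmod (fourier_coeff f 0)))" by simp
  moreover have "0 \<le> 2 * (r ^ Suc M / (1 - r))"
    using r by (intro mult_nonneg_nonneg divide_nonneg_nonneg) auto
  ultimately have "0 \<le> ?C" by (rule add_nonneg_nonneg)
  then show ?thesis using False by (simp add: wave_def)
next
  case True
  define K where "K x = (\<Sum>j\<le>M. of_real (r ^ j / real j) *
      (wave k (N + int j) x * cnj (wave k (N + int j) y) + wave k (N - int j) x * cnj (wave k (N - int j) y)))" for x
  let ?l = "\<lambda>x. indicator full_set x * (2 * ln 2 - ln (cmod (1 - of_real r * (ratio x * cnj (ratio y)))))"
  have S_eq: "?S = integral\<^sup>L (lebesgue_on torus) K"
    unfolding K_def bcoef_eq by (simp add: wave_integrable)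
  have [measurable]: "K \<in> borel_measurable (lebesgue_on torus)" unfolding K_def by measurable
  note bound = kernel_bounds[OF _ True r]
  have K_le: "cmod (K x) \<le> 2 * ?l x + 2 * (r ^ Suc M / (1 - r))" for x
  proof (cases "x \<in> full_set")
    case False
    then show ?thesis using r by (simp add: K_def wave_def)
  next
    case x: True
    define z where "z = ratio x * cnj (ratio y)"
    have z: "cmod z = 1" using norm_ratio[OF x] norm_ratio[OF True] by (simp add: z_def norm_mult)
    have "K x = (wave k N x * cnj (wave k N y)) * of_real (2 * (\<Sum>j\<le>M. r ^ j / real j * Re (z ^ j)))"
      unfolding K_def wave_kernel[OF x True] z_def[symmetric]
      by (simp add: sum_distrib_left mult_ac)
    then have "cmod (K x) = 2 * \<bar>\<Sum>j\<le>M. r ^ j / real j * Re (z ^ j)\<bar>"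
      using x True by (simp only: norm_mult norm_wave complex_mod_cnj norm_of_real) (simp add: abs_mult)
    also have "\<bar>\<Sum>j\<le>M. r ^ j / real j * Re (z ^ j)\<bar> \<le> \<bar>ln (cmod (1 - of_real r * z))\<bar> + r ^ Suc M / (1 - r)"
      using log_series_bound[OF z r, of M] by linarith
    also have "\<bar>ln (cmod (1 - of_real r * z))\<bar> \<le> 2 * ln 2 - ln (cmod (1 - of_real r * z))"
      using bound[OF x] r by (intro log_slack) (auto simp: z_def)
    finally show ?thesis using x by (simp add: z_def)
  qed
  note l_int = log_kernel_integrable[OF True r]
  have K_int: "integrable (lebesgue_on torus) (\<lambda>x. cmod (K x))"
    unfolding K_def by (intro integrable_norm) (simp add: wave_integrable)
  have "cmod ?S \<le> (\<integral>x. cmod (K x) \<partial>lebesgue_on torus)"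
    unfolding S_eq by (rule integral_norm_bound)
  also have "\<dots> \<le> (\<integral>x. 2 * ?l x + 2 * (r ^ Suc M / (1 - r)) \<partial>lebesgue_on torus)"
    by (intro integral_mono K_int K_le) (use l_int in auto)
  also have "\<dots> = 2 * (\<integral>x. ?l x \<partial>lebesgue_on torus) + 2 * (r ^ Suc M / (1 - r))"
    using l_int by simp
  also have "\<dots> \<le> ?C"
    using log_kernel_bound[OF True r] by simp
  finally show ?thesis .
qed

text \<open>Integrating the previous sum over \<open>y\<close> turns each conjugated wave into a
  conjugated coefficient, hence each product into a squared modulus. The bound is uniform in
  \<open>y\<close> and the torus has mass 1.\<close>

lemma energy_bound_abel:
  assumes r: "0 < r" "r < 1"
  shows "(\<Sum>j\<le>M. r ^ j / real j * ((cmod (bcoef f \<nu> (N + int j) k))\<^sup>2 + (cmod (bcoef f \<nu> (N - int j) k))\<^sup>2))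
    \<le> 2 * (2 * ln 2 - ln (r * cmod (fourier_coeff f 0))) + 2 * (r ^ Suc M / (1 - r))" (is "?E \<le> ?C")
proof -
  let ?b = "\<lambda>m. bcoef f \<nu> m k"
  define a where "a y = (\<Sum>j\<le>M. of_real (r ^ j / real j) *
      (?b (N + int j) * cnj (wave k (N + int j) y) + ?b (N - int j) * cnj (wave k (N - int j) y)))" for y
  have "integral\<^sup>L (lebesgue_on torus) a = (\<Sum>j\<le>M. of_real (r ^ j / real j) *
      (?b (N + int j) * cnj (?b (N + int j)) + ?b (N - int j) * cnj (?b (N - int j))))"
    unfolding a_def by (simp add: wave_integrable bcoef_eq)
  also have "\<dots> = of_real ?E"
    by (simp only: of_real_sum of_real_mult of_real_add complex_norm_square)
  finally have "?E = Re (integral\<^sup>L (lebesgue_on torus) a)" by (simp only: Re_complex_of_real)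
  also have "\<dots> \<le> cmod (integral\<^sup>L (lebesgue_on torus) a)" by (rule complex_Re_le_cmod)
  also have "\<dots> \<le> (\<integral>y. cmod (a y) \<partial>lebesgue_on torus)" by (rule integral_norm_bound)
  also have "\<dots> \<le> (\<integral>y. ?C \<partial>lebesgue_on (torus::(real^'n) set))"
  proof (rule integral_mono)
    show "integrable (lebesgue_on torus) (\<lambda>y. cmod (a y))"
      unfolding a_def by (intro integrable_norm) (simp add: wave_integrable)
    show "cmod (a y) \<le> ?C" if "y \<in> space (lebesgue_on torus)" for y
      unfolding a_def using energy_kernel_bound[OF r] that by simp
  qed simp
  finally show ?thesis by simp
qed

text \<open>The remainder blows up as \<open>r\<close> tends to 1 with the length of the sum fixed.
  So the length of the sum goes to infinity first, which removes the remainder, and only then does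
  \<open>r\<close> tend to 1.\<close>

lemma energy_bound:
  "(\<Sum>j\<le>M. 1 / real j * ((cmod (bcoef f \<nu> (N + int j) k))\<^sup>2 + (cmod (bcoef f \<nu> (N - int j) k))\<^sup>2))
    \<le> ln (16 / cmod (fourier_coeff f 0) ^ 4)"
proof -
  let ?a = "cmod (fourier_coeff f 0)"
  define B where "B j = (cmod (bcoef f \<nu> (N + int j) k))\<^sup>2 + (cmod (bcoef f \<nu> (N - int j) k))\<^sup>2" for j
  have B: "0 \<le> B j" for j by (simp add: B_def)
  have 1: "(\<Sum>j\<le>M. r ^ j / real j * B j) \<le> 2 * (2 * ln 2 - ln (r * ?a))" if r: "0 < r" "r < 1" for r
  proof (rule LIMSEQ_le_const)
    have "(\<lambda>n. r ^ Suc n) \<longlonglongrightarrow> 0"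
      using r by (intro LIMSEQ_power_zero[THEN LIMSEQ_Suc]) auto
    from tendsto_divide[OF this tendsto_const[of "1 - r"]]
    show "(\<lambda>n. 2 * (2 * ln 2 - ln (r * ?a)) + 2 * (r ^ Suc n / (1 - r))) \<longlonglongrightarrow> 2 * (2 * ln 2 - ln (r * ?a))"
      using r by (auto intro!: tendsto_eq_intros)
    \<comment> \<open>The terms are nonnegative, so the sum up to \<open>M\<close> is at most the
      longer sum up to \<open>n\<close>.\<close>
    have "(\<Sum>j\<le>M. r ^ j / real j * B j) \<le> 2 * (2 * ln 2 - ln (r * ?a)) + 2 * (r ^ Suc n / (1 - r))" if "M \<le> n" for n
    proof -
      have "(\<Sum>j\<le>M. r ^ j / real j * B j) \<le> (\<Sum>j\<le>n. r ^ j / real j * B j)"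
        using that B r by (intro sum_mono2) auto
      then show ?thesis using energy_bound_abel[OF r, where M = n and N = N and k = k] by (simp add: B_def)
    qed
    then show "\<exists>n0. \<forall>n\<ge>n0. (\<Sum>j\<le>M. r ^ j / real j * B j) \<le> 2 * (2 * ln 2 - ln (r * ?a)) + 2 * (r ^ Suc n / (1 - r))"
      by blast
  qed
  have "(\<Sum>j\<le>M. 1 ^ j / real j * B j) \<le> 2 * (2 * ln 2 - ln (1 * ?a))"
  proof (rule tendsto_le)
    show "((\<lambda>r. \<Sum>j\<le>M. r ^ j / real j * B j) \<longlongrightarrow> (\<Sum>j\<le>M. 1 ^ j / real j * B j)) (at_left 1)"
      unfolding divide_inverse
      by (intro tendsto_sum tendsto_mult tendsto_power tendsto_const tendsto_ident_at)
    show "((\<lambda>r. 2 * (2 * ln 2 - ln (r * ?a))) \<longlongrightarrow> 2 * (2 * ln 2 - ln (1 * ?a))) (at_left 1)"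
      using f_mean by (intro tendsto_intros) auto
    show "\<forall>\<^sub>F r in at_left 1. (\<Sum>j\<le>M. r ^ j / real j * B j) \<le> 2 * (2 * ln 2 - ln (r * ?a))"
      using eventually_at_left_real[OF zero_less_one] by eventually_elim (use 1 in auto)
  qed simp
  \<comment> \<open>Since \<open>?a\<close> is at most 1, its logarithm is at most 0, and the
    coefficient 2 of \<open>- ln ?a\<close> may be raised to 4.\<close>
  also have "\<dots> \<le> 4 * ln 2 - 4 * ln ?a"
    using f_mean f_mean_le_1 by simp
  also have "\<dots> = ln (16 / ?a ^ 4)"
    using f_mean ln_realpow[of 2 4] ln_realpow[of ?a 4] by (simp add: ln_div)
  finally show ?thesis by (simp add: B_def)
qed

end

section \<open>From an essential bound to a pointwise one, and from finite sums to the full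
  series\<close>

theorem theorem1:
  fixes f :: "real^'n \<Rightarrow> complex" and \<nu> :: "int^'n" and S :: "(int^'n) set"
    and N k :: int
  assumes "f \<in> borel_measurable (lebesgue_on torus)"
    and "AE x in lebesgue_on torus. cmod (f x) \<le> 1"
    and "half_space S"
    and "\<forall>\<xi>\<in>S. fourier_coeff f \<xi> = 0"
    and "\<nu> \<in> uminus ` S"
    and "fourier_coeff f 0 \<noteq> 0"
  shows "(\<lambda>m. (cmod (bcoef f \<nu> m k))\<^sup>2 / \<bar>real_of_int (m - N)\<bar>) summable_on (UNIV - {N}) \<and>
         (\<Sum>\<^sub>\<infinity>m\<in>UNIV - {N}. (cmod (bcoef f \<nu> m k))\<^sup>2 / \<bar>real_of_int (m - N)\<bar>)
           \<le> ln (16 / cmod (fourier_coeff f 0) ^ 4)"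
proof -
  \<comment> \<open>A version of \<open>f\<close> bounded by 1 at every point. It differs from
    \<open>f\<close> on a null set only, so the Fourier coefficients are unchanged.\<close>
  define g where "g x = (if cmod (f x) \<le> 1 then f x else 0)" for x
  note [measurable] = assms(1)
  have g_meas [measurable]: "g \<in> borel_measurable (lebesgue_on torus)"
    unfolding g_def by measurable
  have g_le: "cmod (g x) \<le> 1" for x by (simp add: g_def)
  have coeff: "fourier_coeff g \<xi> = fourier_coeff f \<xi>" for \<xi>
    unfolding fourier_coeff_character
    by (intro integral_cong_AE) (use assms(2) in \<open>auto simp: g_def\<close>)
  \<comment> \<open>Where \<open>f\<close> was altered, neither modulus is 1, so the two sets
    coincide exactly and the two functions agree on them.\<close>
  have "{x \<in> torus. cmod (g x) = 1} = {x \<in> torus. cmod (f x) = 1}"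
    by (auto simp: g_def)
  then have b: "bcoef g \<nu> m k = bcoef f \<nu> m k" for m
    unfolding bcoef_def by (auto simp: g_def intro!: Bochner_Integration.integral_cong)
  interpret half_space_contraction g \<nu> S
    using assms by unfold_locales (auto simp: coeff g_le)
  define t where "t m = (cmod (bcoef f \<nu> m k))\<^sup>2 / \<bar>real_of_int (m - N)\<bar>" for m
  have fin: "sum t F \<le> ln (16 / cmod (fourier_coeff f 0) ^ 4)" if F: "finite F" "F \<subseteq> UNIV - {N}" for F
  proof -
    \<comment> \<open>The largest distance from \<open>N\<close> within \<open>F\<close>; the
      inserted 0 covers empty \<open>F\<close>.\<close>
    define M where "M = Max (insert 0 ((\<lambda>m. nat \<bar>m - N\<bar>) ` F))"
    let ?P = "(\<lambda>j. N + int j) ` {1..M}" and ?Q = "(\<lambda>j. N - int j) ` {1..M}"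
    have "F \<subseteq> ?P \<union> ?Q"
    proof
      fix m assume m: "m \<in> F"
      then have le: "nat \<bar>m - N\<bar> \<le> M" unfolding M_def using F by (intro Max_ge) auto
      have "m \<noteq> N" using m F by auto
      then show "m \<in> ?P \<union> ?Q"
      proof (cases "m > N")
        case True
        with le have "m \<in> ?P" by (intro image_eqI[of _ _ "nat (m - N)"]) auto
        then show ?thesis ..
      next
        case False
        with le \<open>m \<noteq> N\<close> have "m \<in> ?Q" by (intro image_eqI[of _ _ "nat (N - m)"]) auto
        then show ?thesis ..
      qed
    qed
    then have "sum t F \<le> sum t (?P \<union> ?Q)"
      by (intro sum_mono2) (auto simp: t_def)
    also have "\<dots> = sum t ?P + sum t ?Q" by (intro sum.union_disjoint) auto
    also have "\<dots> = (\<Sum>j\<in>{1..M}. t (N + int j) + t (N - int j))"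
      by (simp add: sum.reindex inj_on_def sum.distrib)
    also have "\<dots> = (\<Sum>j\<in>{1..M}. 1 / real j *
        ((cmod (bcoef g \<nu> (N + int j) k))\<^sup>2 + (cmod (bcoef g \<nu> (N - int j) k))\<^sup>2))"
      by (intro sum.cong) (auto simp: t_def b add_divide_distrib)
    also have "\<dots> = (\<Sum>j\<le>M. 1 / real j *
        ((cmod (bcoef g \<nu> (N + int j) k))\<^sup>2 + (cmod (bcoef g \<nu> (N - int j) k))\<^sup>2))"
      by (intro sum.mono_neutral_left) auto
    also have "\<dots> \<le> ln (16 / cmod (fourier_coeff g 0) ^ 4)"
      by (rule energy_bound)
    finally show ?thesis by (simp add: coeff)
  qed
  have "t summable_on (UNIV - {N})"
    using fin by (intro nonneg_bdd_above_summable_on) (auto simp: t_def intro!: bdd_aboveI2)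
  then show ?thesis
    using infsum_le_finite_sums[OF _ fin] unfolding t_def by blast
qed

end
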